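(* Let $n\ge 2$ and $s\ge 3$ be integers, let $A$ be a unital algebra over a commutative unital ring $\mathcal{R}$, and let $\mathcal{A}=T_s(A)$ be the algebra of upper triangular $s\times s$ matrices over $A$. Suppose that $\mathcal{A}$ is $2$- and $(n-1)$-torsion free. Then every Lie $n$-derivation on $T_s(A)$ is standard.
   Context: Linear means $\mathcal{R}$-linear; $\mathcal{Z}(\mathcal{A})$ is the centre of $\mathcal{A}$. For a positive integer $k$, $\mathcal{A}$ is $k$-torsion free if $kx=0$ implies $x=0$ for each $x\in\mathcal{A}$. $[x,y]=xy-yx$. Define $p_1(x_1)=x_1$ and $p_n(x_1,\dots,x_n)=[p_{n-1}(x_1,\dots,x_{n-1}),x_n]$ for $n\ge2$; for $n\ge 2$, $p_n(x_1,\dots,x_n)$ is called an $(n-1)$-th commutator. A linear map $\varphi:\mathcal{A}\to\mathcal{A}$ is a Lie $n$-derivation if $\varphi(p_n(x_1,\dots,x_n))=\sum_{i=1}^n p_n(x_1,\dots,x_{i-1},\varphi(x_i),x_{i+1},\dots,x_n)$ for all $x_1,\dots,x_n\in\mathcal{A}$. A Lie $n$-derivation is standard if it equals $h+\tau$ with $h$ a derivation on $\mathcal{A}$ (linear, $h(xy)=h(x)y+xh(y)$) and $\tau$ a linear mapping from $\mathcal{A}$ into $\mathcal{Z}(\mathcal{A})$ vanishing on all $(n-1)$-th commutators of $\mathcal{A}$. *)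

theory Defs
  imports "HOL-Analysis.Finite_Cartesian_Product"
begin

section \<open>Unital algebras\<close>

text \<open>
  Associative unital algebras over a commutative unital ring, not necessarily commutative.  The
  sorts \<open>{comm_ring, comm_monoid_mult}\<close> and \<open>{ring, monoid_mult}\<close> are \<open>comm_ring_1\<close> and \<open>ring_1\<close>
  without \<open>0 \<noteq> 1\<close>, so that zero rings and zero algebras are admitted; this is why the
  library locale \<open>module\<close>, whose first four axioms coincide with those below, is not imported.
\<close>

locale unital_algebra =
  fixes smul :: "'r::{comm_ring, comm_monoid_mult} \<Rightarrow> 'a::{ring, monoid_mult} \<Rightarrow> 'a"
  assumes smul_right_distrib: "smul r (x + y) = smul r x + smul r y"
    and smul_left_distrib: "smul (r + t) x = smul r x + smul t x"
    and smul_smul: "smul r (smul t x) = smul (r * t) x"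
    and smul_one: "smul 1 x = x"
    and smul_mult_left: "smul r x * y = smul r (x * y)"
    and smul_mult_right: "x * smul r y = smul r (x * y)"
begin

lemma smul_zero_right [simp]: "smul r 0 = 0"
  using smul_right_distrib [of r 0 0] by simp

lemma smul_sum_right: "smul r (\<Sum>i\<in>I. f i) = (\<Sum>i\<in>I. smul r (f i))"
  by (induction I rule: infinite_finite_induct) (simp_all add: smul_right_distrib)

end

definition linear_map :: "('r \<Rightarrow> 'a::ring \<Rightarrow> 'a) \<Rightarrow> ('a \<Rightarrow> 'a) \<Rightarrow> bool" where
  "linear_map smul f \<longleftrightarrow>
     (\<forall>x y. f (x + y) = f x + f y) \<and> (\<forall>r x. f (smul r x) = smul r (f x))"

definition centre :: "'a::ring set" where
  "centre = {z. \<forall>x. z * x = x * z}"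

text \<open>\<open>k x\<close> is written as a sum of \<open>k\<close> copies of \<open>x\<close>, since \<open>of_nat\<close> needs \<open>0 \<noteq> 1\<close>.\<close>

definition torsion_free :: "nat \<Rightarrow> 'a::ring itself \<Rightarrow> bool" where
  "torsion_free k _ \<longleftrightarrow> (\<forall>x::'a. (\<Sum>i<k. x) = 0 \<longrightarrow> x = 0)"


section \<open>Lie n-derivations\<close>

definition commutator :: "'a::ring \<Rightarrow> 'a \<Rightarrow> 'a" where
  "commutator x y = x * y - y * x"

text \<open>
  \<open>lie_poly n x\<close> is \<open>p\<^sub>n(x\<^sub>1, \<dots>, x\<^sub>n)\<close>; it depends on \<open>x 1, \<dots>, x n\<close> only.  The value at \<open>n = 0\<close> is
  a dummy.
\<close>

fun lie_poly :: "nat \<Rightarrow> (nat \<Rightarrow> 'a::ring) \<Rightarrow> 'a" where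
  "lie_poly 0 x = 0"
| "lie_poly (Suc 0) x = x 1"
| "lie_poly (Suc (Suc n)) x = commutator (lie_poly (Suc n) x) (x (Suc (Suc n)))"

definition lie_n_derivation :: "('r \<Rightarrow> 'a::ring \<Rightarrow> 'a) \<Rightarrow> nat \<Rightarrow> ('a \<Rightarrow> 'a) \<Rightarrow> bool" where
  "lie_n_derivation smul n \<phi> \<longleftrightarrow>
     linear_map smul \<phi> \<and>
     (\<forall>x. \<phi> (lie_poly n x) = (\<Sum>i = 1..n. lie_poly n (x(i := \<phi> (x i)))))"

definition derivation :: "('r \<Rightarrow> 'a::ring \<Rightarrow> 'a) \<Rightarrow> ('a \<Rightarrow> 'a) \<Rightarrow> bool" where
  "derivation smul h \<longleftrightarrow>
     linear_map smul h \<and> (\<forall>x y. h (x * y) = h x * y + x * h y)"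

definition standard_lie_n_derivation :: "('r \<Rightarrow> 'a::ring \<Rightarrow> 'a) \<Rightarrow> nat \<Rightarrow> ('a \<Rightarrow> 'a) \<Rightarrow> bool" where
  "standard_lie_n_derivation smul n \<phi> \<longleftrightarrow>
     lie_n_derivation smul n \<phi> \<and>
     (\<exists>h \<tau>. derivation smul h \<and>
            linear_map smul \<tau> \<and> range \<tau> \<subseteq> centre \<and> (\<forall>x. \<tau> (lie_poly n x) = 0) \<and>
            (\<forall>x. \<phi> x = h x + \<tau> x))"


section \<open>The algebra of upper triangular matrices\<close>

text \<open>
  The rows and columns are indexed by a finite linearly ordered type \<open>'s\<close>; for \<open>CARD('s) = s\<close> this
  is the algebra of upper triangular \<open>s \<times> s\<close> matrices.
\<close>

typedef (overloaded) ('a::zero, 's::"{finite, linorder}") ut_matrix =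
  "{M :: (('a, 's) vec, 's) vec. \<forall>i j. j < i \<longrightarrow> M $ i $ j = 0}"
  morphisms entries Abs_ut_matrix
  by (rule exI [of _ "\<chi> i j. 0"]) simp

setup_lifting type_definition_ut_matrix

lemma entries_below_diagonal: "j < i \<Longrightarrow> entries M $ i $ j = 0"
  using entries [of M] by simp

lemma ut_matrix_eq_iff:
  fixes M N :: "('a::zero, 's::{finite, linorder}) ut_matrix"
  shows "M = N \<longleftrightarrow> (\<forall>i j. entries M $ i $ j = entries N $ i $ j)"
  by (simp add: entries_inject [symmetric] vec_eq_iff)

lemma if_times: "(if P then 1 else 0) * (x::'a::{ring, monoid_mult}) = (if P then x else 0)"
  and times_if: "x * (if P then 1 else 0) = (if P then x else 0)"
  by simp_all

text \<open>
  The product is the matrix product; the constant \<open>**\<close> of the library is restricted to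
  \<open>semiring_1\<close>, where \<open>0 \<noteq> 1\<close>.
\<close>

instantiation ut_matrix :: ("{ring, monoid_mult}", "{finite, linorder}") "{ring, monoid_mult}"
begin

lift_definition zero_ut_matrix :: "('a, 'b) ut_matrix" is "0"
  by simp

lift_definition one_ut_matrix :: "('a, 'b) ut_matrix" is "mat 1"
  by (auto simp: mat_def)

lift_definition plus_ut_matrix :: "('a, 'b) ut_matrix \<Rightarrow> ('a, 'b) ut_matrix \<Rightarrow> ('a, 'b) ut_matrix"
  is "(+)"
  by simp

lift_definition minus_ut_matrix :: "('a, 'b) ut_matrix \<Rightarrow> ('a, 'b) ut_matrix \<Rightarrow> ('a, 'b) ut_matrix"
  is "(-)"
  by simp

lift_definition uminus_ut_matrix :: "('a, 'b) ut_matrix \<Rightarrow> ('a, 'b) ut_matrix"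
  is "uminus"
  by simp

lift_definition times_ut_matrix :: "('a, 'b) ut_matrix \<Rightarrow> ('a, 'b) ut_matrix \<Rightarrow> ('a, 'b) ut_matrix"
  is "\<lambda>M N. \<chi> i j. \<Sum>k\<in>UNIV. M $ i $ k * N $ k $ j"
  apply (simp, intro allI impI sum.neutral ballI)
  subgoal for M N i j k by (cases "k < i") auto
  done

instance
proof
  fix a b c :: "('a, 'b) ut_matrix"
  show "a + b + c = a + (b + c)" by transfer (simp add: add.assoc)
  show "a + b = b + a" by transfer (simp add: add.commute)
  show "0 + a = a" by transfer simp
  show "- a + a = 0" by transfer simp
  show "a - b = a + - b" by transfer simp
  show "a * b * c = a * (b * c)"
  proof (transfer, simp add: vec_eq_iff sum_distrib_left sum_distrib_right mult.assoc, intro allI)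
    fix a b c :: "(('a, 'b) vec, 'b) vec" and i j :: 'b
    show "(\<Sum>k\<in>UNIV. \<Sum>l\<in>UNIV. a $ i $ l * (b $ l $ k * c $ k $ j)) =
          (\<Sum>l\<in>UNIV. \<Sum>k\<in>UNIV. a $ i $ l * (b $ l $ k * c $ k $ j))"
      by (rule sum.swap)
  qed
  show "(a + b) * c = a * c + b * c"
    by transfer (simp add: vec_eq_iff distrib_right sum.distrib)
  show "a * (b + c) = a * b + a * c"
    by transfer (simp add: vec_eq_iff distrib_left sum.distrib)
  show "1 * a = a"
    by transfer (simp add: vec_eq_iff mat_def if_times)
  show "a * 1 = a"
    by transfer (simp add: vec_eq_iff mat_def times_if)
qed

end

text \<open>
  Entrywise scalar multiplication.  The case distinction only makes the function well defined
  for arbitrary \<open>smul\<close>; see \<open>entries_ut_smul\<close>.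
\<close>

lift_definition ut_smul ::
  "('r \<Rightarrow> 'a \<Rightarrow> 'a) \<Rightarrow> 'r \<Rightarrow> ('a::zero, 's::{finite, linorder}) ut_matrix \<Rightarrow> ('a, 's) ut_matrix"
  is "\<lambda>smul r M. \<chi> i j. if j < i then 0 else smul r (M $ i $ j)"
  by auto

lemma (in unital_algebra) entries_ut_smul:
  "entries (ut_smul smul r M) $ i $ j = smul r (entries M $ i $ j)"
  by (simp add: ut_smul.rep_eq entries_below_diagonal)

lemma entries_plus: "entries (M + N) $ i $ j = entries M $ i $ j + entries N $ i $ j"
  by (simp add: plus_ut_matrix.rep_eq)

lemma entries_times:
  "entries (M * N) $ i $ j = (\<Sum>k\<in>UNIV. entries M $ i $ k * entries N $ k $ j)"
  by (simp add: times_ut_matrix.rep_eq)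

lemma (in unital_algebra) unital_algebra_ut_smul:
  "unital_algebra (ut_smul smul :: 'r \<Rightarrow> ('a, 's::{finite, linorder}) ut_matrix \<Rightarrow> _)"
  by standard
    (simp_all add: ut_matrix_eq_iff entries_ut_smul entries_plus entries_times smul_sum_right
      smul_right_distrib smul_left_distrib smul_smul smul_one smul_mult_left smul_mult_right)

end

theory Submission
  imports Defs
begin

text \<open>
  Write \<open>f\<^sub>U\<close> for the diagonal idempotent supported on an up-set \<open>U\<close> of indices.  Triangularity
  says that \<open>f x f = f x\<close> for \<open>f = f\<^sub>U\<close>, so \<open>x \<mapsto> [x, f]\<close> is the projection onto the block with rows
  outside \<open>U\<close> and columns in \<open>U\<close>.  Every \<open>n\<close>-fold commutator whose last \<open>n - 2\<close> arguments are \<open>f\<close> is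
  therefore almost an ordinary commutator, and the proof reduces the general case to \<open>n = 2\<close>.

  If \<open>m\<close> lies in the block, then \<open>m = [m, f, \<dots>, f]\<close>, and expanding \<open>\<phi> m\<close> gives
  \<open>(n - 1) [m, \<phi> f] = 0\<close>.  By torsion freeness \<open>\<phi> f\<close> commutes with the block
  (\<open>lie_n_derivation_block\<close>), and the commutant of a block consists of central scalars up to terms
  in the block itself (\<open>block_commutant\<close>).  These terms for the various \<open>U\<close> fit together, because the
  \<open>f\<^sub>U\<close> commute, into one matrix \<open>w\<close>; subtracting the inner derivation \<open>[w, \<cdot>]\<close> makes every \<open>\<phi> f\<^sub>U\<close>
  central (\<open>lie_n_derivation_normalise\<close>).

  A Lie \<open>n\<close>-derivation with all \<open>\<phi> f\<^sub>U\<close> central commutes with the projections onto blocks, hence onto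
  single off-diagonal entries, and satisfies \<open>\<phi> [x, y] = [\<phi> x, y] + [x, \<phi> y]\<close> in all off-diagonal
  entries.  Let \<open>x\<close> be supported in the diagonal position \<open>i\<close>.  Then \<open>\<phi> x\<close> is diagonal, and
  because \<open>x\<close> commutes with all matrix units \<open>e\<^sub>p\<^sub>q\<close> for \<open>p, q \<noteq> i\<close>, the entries of \<open>\<phi> x\<close> at the
  positions other than \<open>i\<close> are equal; as \<open>s \<ge> 3\<close>, there are two such positions, and the common
  value is central.  Subtracting it, as a scalar matrix, from \<open>\<phi> x\<close>
  leaves a map that preserves all positions and obeys the product rule on matrix units:
  off-diagonal products are commutators, and diagonal products are detected by multiplying with
  an off-diagonal unit (\<open>derivation_derivation_part\<close>).

  What has been subtracted is a linear map into the centre.  It kills \<open>n\<close>-fold commutators because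
  it is itself a Lie \<open>n\<close>-derivation (\<open>standard_if_derivation_plus_central\<close>).
\<close>

section \<open>Commutators and Lie polynomials in a ring\<close>

lemma linear_map_add: "linear_map smul f \<Longrightarrow> f (x + y) = f x + f y"
  by (simp add: linear_map_def)

lemma linear_map_diff:
  assumes "linear_map smul f"
  shows "f (x - y) = f x - f y"
  using linear_map_add [OF assms, of "x - y" y] by simp

lemma linear_map_zero: "linear_map smul f \<Longrightarrow> f 0 = 0"
  using linear_map_diff [of smul f 0 0] by simp

lemma commutator_diff_left: "commutator (x - y) z = commutator x z - commutator y z"
  and commutator_diff_right: "commutator x (y - z) = commutator x y - commutator x z"
  and commutator_add_left: "commutator (x + y) z = commutator x z + commutator y z"
  and commutator_zero [simp]: "commutator 0 z = 0" "commutator z 0 = 0"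
  by (simp_all add: commutator_def algebra_simps)

lemma commutator_central:
  "c \<in> centre \<Longrightarrow> commutator c x = 0" "c \<in> centre \<Longrightarrow> commutator x c = 0"
  by (simp_all add: commutator_def centre_def)

lemma commutator_sum_left: "commutator (\<Sum>i\<in>I. g i) z = (\<Sum>i\<in>I. commutator (g i) z)"
  by (induction I rule: infinite_finite_induct) (simp_all add: commutator_add_left)

lemma lie_poly_Suc:
  "1 \<le> n \<Longrightarrow> lie_poly (Suc n) x = commutator (lie_poly n x) (x (Suc n))"
  by (cases n) simp_all

lemma lie_poly_update_beyond: "n < i \<Longrightarrow> lie_poly n (x(i := a)) = lie_poly n x"
  by (induction n x rule: lie_poly.induct) simp_all

lemma lie_poly_Suc_update:
  assumes "1 \<le> n"
  shows "lie_poly (Suc n) (x(i := a)) =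
    (if i = Suc n then commutator (lie_poly n x) a
     else commutator (lie_poly n (x(i := a))) (x (Suc n)))"
proof (cases "i = Suc n")
  case True
  then have "lie_poly n (x(i := a)) = lie_poly n x"
    by (intro lie_poly_update_beyond) simp
  then show ?thesis
    by (simp only: lie_poly_Suc [OF assms] True fun_upd_same if_True simp_thms)
next
  case False
  then show ?thesis
    by (simp add: lie_poly_Suc [OF assms])
qed

lemma lie_poly_update_diff:
  assumes "1 \<le> i" "i \<le> n"
  shows "lie_poly n (x(i := a - b)) = lie_poly n (x(i := a)) - lie_poly n (x(i := b))"
  using assms(2,1)
proof (induction n rule: nat_induct)
  case (Suc n)
  show ?case
  proof (cases "n = 0")
    case False
    then show ?thesis
      using Suc
      by (cases "i = Suc n")
        (auto simp: lie_poly_Suc_update commutator_diff_left commutator_diff_right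
          simp del: lie_poly.simps fun_upd_apply)
  qed (use Suc.prems in auto)
qed simp

lemma lie_poly_central_argument:
  assumes "c \<in> centre" "2 \<le> n" "1 \<le> i" "i \<le> n"
  shows "lie_poly n (x(i := c)) = 0"
  using assms(2-)
proof (induction n rule: dec_induct)
  case base
  then have "i = 1 \<or> i = 2"
    by auto
  then show ?case
    using assms(1) by (auto simp: numeral_2_eq_2 commutator_central)
next
  case (step n)
  then show ?case
    using assms(1)
    by (cases "i = Suc n") (auto simp: lie_poly_Suc_update commutator_central
        simp del: lie_poly.simps fun_upd_apply)
qed

lemma derivation_commutator:
  assumes "derivation smul h"
  shows "h (commutator x y) = commutator (h x) y + commutator x (h y)"
proof -
  have "linear_map smul h" and "\<And>x y. h (x * y) = h x * y + x * h y"
    using assms by (simp_all add: derivation_def)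
  then show ?thesis
    by (simp add: commutator_def linear_map_diff algebra_simps)
qed

lemma lie_n_derivation_if_derivation:
  assumes "derivation smul h"
  shows "lie_n_derivation smul n h"
proof -
  have lin: "linear_map smul h"
    using assms by (simp add: derivation_def)
  have "h (lie_poly n x) = (\<Sum>i = 1..n. lie_poly n (x(i := h (x i))))" for x
  proof (induction n)
    case 0
    show ?case
      by (simp add: linear_map_zero [OF lin])
  next
    case (Suc n)
    show ?case
    proof (cases "n = 0")
      case False
      have "h (lie_poly (Suc n) x) =
          commutator (h (lie_poly n x)) (x (Suc n)) + commutator (lie_poly n x) (h (x (Suc n)))"
        using False
        by (simp add: lie_poly_Suc derivation_commutator [OF assms]
            del: lie_poly.simps fun_upd_apply)
      then show ?thesis
        using False Suc.IH
        by (simp add: lie_poly_Suc_update commutator_sum_left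
            del: lie_poly.simps fun_upd_apply)
    qed simp
  qed
  then show ?thesis
    using lin by (simp add: lie_n_derivation_def)
qed

lemma lie_n_derivation_diff:
  assumes "unital_algebra smul" "lie_n_derivation smul n f" "lie_n_derivation smul n g"
  shows "lie_n_derivation smul n (\<lambda>x. f x - g x)"
proof -
  interpret unital_algebra smul by fact
  have smul_diff: "smul r (x - y) = smul r x - smul r y" for r x y
    using smul_right_distrib [of r "x - y" y] by simp
  show ?thesis
    using assms(2,3)
    by (auto simp: lie_n_derivation_def linear_map_def smul_diff lie_poly_update_diff sum_subtractf)
qed

lemma derivation_inner:
  assumes "unital_algebra smul"
  shows "derivation smul (commutator w)"
proof -
  interpret unital_algebra smul by fact
  have smul_diff: "smul r (x - y) = smul r x - smul r y" for r x y
    using smul_right_distrib [of r "x - y" y] by simp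
  show ?thesis
    by (simp add: derivation_def linear_map_def commutator_def smul_diff smul_mult_left
        smul_mult_right algebra_simps)
qed

text \<open>
  The central summand \<open>\<tau> = \<phi> - h\<close> is a difference of two Lie \<open>n\<close>-derivations, so \<open>\<tau>\<close> of an \<open>n\<close>-fold
  commutator is a sum of \<open>n\<close>-fold commutators, each of which has a central argument.
\<close>

lemma standard_if_derivation_plus_central:
  assumes alg: "unital_algebra smul" and "2 \<le> n"
    and phi: "lie_n_derivation smul n \<phi>" and h: "derivation smul h"
    and central: "\<And>x. \<phi> x - h x \<in> centre"
  shows "standard_lie_n_derivation smul n \<phi>"
proof -
  let ?\<tau> = "\<lambda>x. \<phi> x - h x"
  have \<tau>: "lie_n_derivation smul n ?\<tau>"
    by (intro lie_n_derivation_diff alg phi lie_n_derivation_if_derivation h)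
  then have "?\<tau> (lie_poly n x) = (\<Sum>i = 1..n. lie_poly n (x(i := ?\<tau> (x i))))" for x
    by (simp add: lie_n_derivation_def)
  then have "?\<tau> (lie_poly n x) = 0" for x
    using \<open>2 \<le> n\<close> central by (simp add: lie_poly_central_argument)
  moreover have "linear_map smul ?\<tau>"
    using \<tau> by (simp add: lie_n_derivation_def)
  ultimately show ?thesis
    unfolding standard_lie_n_derivation_def
    using phi h central by (intro conjI exI [of _ h] exI [of _ ?\<tau>]) auto
qed

section \<open>Semicentral idempotents\<close>

text \<open>
  For such an idempotent \<open>f\<close> and \<open>e = 1 - f\<close>, one has \<open>[x, f] = e x f\<close>: the ring is triangular with
  respect to \<open>e\<close> and \<open>f\<close>.  The elements \<open>m\<close> of the block \<open>e R f\<close> are those with \<open>[m, f] = m\<close>, a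
  description that makes sense in rings without unit.
\<close>

definition right_semicentral :: "'a::ring \<Rightarrow> bool" where
  "right_semicentral f \<longleftrightarrow> f * f = f \<and> (\<forall>x. f * x * f = f * x)"

lemma right_semicentral_commutator_idem:
  assumes "right_semicentral f"
  shows "commutator (commutator x f) f = commutator x f"
proof -
  have "f * f = f" "f * x * f = f * x"
    using assms by (simp_all add: right_semicentral_def)
  moreover from this have "x * f * f = x * f" "f * (x * f) = f * x" "f * (f * x) = f * x"
    by (simp_all only: mult.assoc [symmetric]) (simp only: mult.assoc \<open>f * f = f\<close>)
  ultimately show ?thesis
    by (simp add: commutator_def left_diff_distrib right_diff_distrib)
qed

text \<open>
  The block is stable under commutators with arbitrary elements: \<open>[\<cdot>, f]\<close> is a derivation that
  maps into the block, and products of two elements of the block vanish, so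
  \<open>[[m, y], f] = [m, y] + [m, [y, f]] = [m, y]\<close>.  The proof computes this from \<open>f m = 0\<close> and
  \<open>m f = m\<close>.
\<close>

lemma right_semicentral_commutator_block:
  assumes f: "right_semicentral f" and m: "commutator m f = m"
  shows "commutator (commutator m y) f = commutator m y"
proof -
  have ff: "f * f = f" and fxf: "f * x * f = f * x" for x
    using f by (simp_all add: right_semicentral_def)
  have "f * m = f * (m * f - f * m)"
    using m by (simp add: commutator_def)
  also have "\<dots> = f * m * f - f * f * m"
    by (simp only: right_diff_distrib mult.assoc)
  also have "\<dots> = 0"
    by (simp only: ff fxf diff_self)
  finally have fm: "f * m = 0" .
  then have mf: "m * f = m"
    using m by (simp add: commutator_def)
  have "m * y * f = m * (f * y * f)"
    by (metis mf mult.assoc)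
  also have "\<dots> = m * y"
    by (metis fxf mf mult.assoc)
  finally have "m * y * f = m * y" .
  moreover have "f * (y * m) = f * y * f * m"
    by (metis fxf mult.assoc)
  then have "f * (y * m) = 0"
    by (simp add: mult.assoc fm)
  moreover have "y * m * f = y * m" "f * (m * y) = 0"
    by (simp_all only: mult.assoc mf) (simp only: mult.assoc [symmetric] fm mult_zero_left)
  ultimately show ?thesis
    by (simp add: commutator_def left_diff_distrib right_diff_distrib)
qed

lemma funpow_commutator_block:
  "commutator y f = y \<Longrightarrow> ((\<lambda>y. commutator y f) ^^ k) y = y"
  by (induction k) simp_all

lemma funpow_commutator_zero: "((\<lambda>y. commutator y f) ^^ k) 0 = 0"
  by (induction k) simp_all

lemma funpow_commutator_semicentral:
  assumes "right_semicentral f"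
  shows "((\<lambda>y. commutator y f) ^^ Suc k) x = commutator x f"
  using assms
  by (induction k) (simp_all add: right_semicentral_commutator_idem)

text \<open>
  The Leibniz rule of a Lie \<open>n\<close>-derivation, \<open>n = k + 2\<close>, at the arguments \<open>a, b, f, \<dots>, f\<close>.  The last
  \<open>k\<close> summands are \<open>[[a, b], f, \<dots>, \<phi> f, \<dots>, f]\<close>.  In all applications they
  coincide, either because \<open>[a, b]\<close> lies in the block of \<open>f\<close>, or because they vanish; hence the
  assumption that \<open>z\<close> does not depend on \<open>j\<close>.
\<close>

lemma lie_n_derivation_iterated_commutator:
  assumes phi: "lie_n_derivation smul (k + 2) \<phi>"
    and z: "\<And>j. commutator (((\<lambda>y. commutator y f) ^^ j) (commutator a b)) (\<phi> f) = z"
    and zf: "commutator z f = z"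
  shows "\<phi> (((\<lambda>y. commutator y f) ^^ k) (commutator a b)) =
    ((\<lambda>y. commutator y f) ^^ k) (commutator (\<phi> a) b + commutator a (\<phi> b)) + (\<Sum>j<k. z)"
proof -
  define x where "x i = (if i = 1 then a else if i = 2 then b else f)" for i :: nat
  have poly: "lie_poly (j + 2) x = ((\<lambda>y. commutator y f) ^^ j) (commutator a b)" for j
    by (induction j) (simp_all add: x_def numeral_2_eq_2)
  have sum: "(\<Sum>i = 1..j + 2. lie_poly (j + 2) (x(i := \<phi> (x i)))) =
     ((\<lambda>y. commutator y f) ^^ j) (commutator (\<phi> a) b + commutator a (\<phi> b)) + (\<Sum>i<j. z)" for j
  proof (induction j)
    case 0
    show ?case
      by (simp add: numeral_2_eq_2 x_def)
  next
    case (Suc j)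
    have "(\<Sum>i = 1..Suc j + 2. lie_poly (Suc j + 2) (x(i := \<phi> (x i)))) =
       (\<Sum>i = 1..j + 2. commutator (lie_poly (j + 2) (x(i := \<phi> (x i)))) f) +
       commutator (lie_poly (j + 2) x) (\<phi> f)"
    proof -
      have "lie_poly (Suc j + 2) (x(i := c)) = commutator (lie_poly (j + 2) (x(i := c))) f"
        if "i \<in> {1..j + 2}" for i c
        using that lie_poly_Suc_update [of "j + 2" x i c]
        by (simp add: x_def [of "Suc (Suc (Suc j))"] del: lie_poly.simps fun_upd_apply)
      moreover have "lie_poly (Suc j + 2) (x(Suc j + 2 := \<phi> (x (Suc j + 2)))) =
          commutator (lie_poly (j + 2) x) (\<phi> f)"
        using lie_poly_Suc_update [of "j + 2" x "Suc j + 2"]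
        by (simp add: x_def [of "Suc (Suc (Suc j))"] del: lie_poly.simps fun_upd_apply)
      ultimately show ?thesis
        by (simp add: sum.cl_ivl_Suc del: lie_poly.simps fun_upd_apply)
    qed
    also have "\<dots> = commutator (\<Sum>i = 1..j + 2. lie_poly (j + 2) (x(i := \<phi> (x i)))) f + z"
      by (simp only: commutator_sum_left poly z)
    also have "\<dots> = ((\<lambda>y. commutator y f) ^^ Suc j) (commutator (\<phi> a) b + commutator a (\<phi> b))
       + (\<Sum>i<Suc j. z)"
      unfolding Suc.IH by (simp add: commutator_add_left commutator_sum_left zf)
    finally show ?case .
  qed
  show ?thesis
    using phi sum [of k] poly [of k] unfolding lie_n_derivation_def by metis
qed

text \<open>
  Since \<open>m = [m, f, \<dots>, f]\<close>, the Leibniz rule reads \<open>\<phi> m = [\<phi> m, f] + (n - 1) z\<close> with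
  \<open>z = [m, \<phi> f]\<close> in the block.  Applying the projection \<open>[\<cdot>, f]\<close> leaves \<open>(n - 1) z = 0\<close>.
\<close>

lemma lie_n_derivation_block:
  assumes phi: "lie_n_derivation smul n \<phi>" and "2 \<le> n"
    and torsion: "torsion_free (n - 1) TYPE('b::ring)"
    and f: "right_semicentral f" and m: "commutator m f = (m :: 'b)"
  shows "commutator m (\<phi> f) = 0"
proof -
  define z where "z = commutator m (\<phi> f)"
  obtain k where n: "n = k + 2"
    using \<open>2 \<le> n\<close> by (metis add.commute le_Suc_ex)
  have zf: "commutator z f = z"
    using right_semicentral_commutator_block [OF f m] by (simp add: z_def)
  have "\<phi> m = ((\<lambda>y. commutator y f) ^^ k) (commutator (\<phi> m) f + z) + (\<Sum>j<k. z)"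
    using lie_n_derivation_iterated_commutator [of smul k \<phi> f m f z] phi
    by (simp add: n m zf funpow_commutator_block flip: z_def)
  also have "\<dots> = commutator (\<phi> m) f + (\<Sum>j<Suc k. z)"
    using right_semicentral_commutator_idem [OF f, of "\<phi> m"]
    by (simp add: funpow_commutator_block commutator_add_left zf add.assoc add.commute)
  finally have eq: "\<phi> m = commutator (\<phi> m) f + (\<Sum>j<Suc k. z)" .
  have "commutator (\<phi> m) f = commutator (commutator (\<phi> m) f + (\<Sum>j<Suc k. z)) f"
    using eq by simp
  also have "\<dots> = commutator (\<phi> m) f + (\<Sum>j<Suc k. z)"
    unfolding commutator_add_left commutator_sum_left zf
    by (simp only: right_semicentral_commutator_idem [OF f])
  finally have "(\<Sum>j<n - 1. z) = 0"
    by (simp add: n)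
  then have "z = 0"
    using torsion unfolding torsion_free_def by blast
  then show ?thesis
    by (simp add: z_def)
qed

text \<open>
  Here all summands of the Leibniz rule in which \<open>\<phi>\<close> hits some \<open>f\<close> vanish, and the \<open>(n - 1)\<close>-fold
  iterate of the projection \<open>[\<cdot>, f]\<close> is the projection itself.
\<close>

lemma lie_n_derivation_commutes_with_block:
  assumes phi: "lie_n_derivation smul n \<phi>" and "2 \<le> n"
    and f: "right_semicentral f" and central: "\<phi> f \<in> centre"
  shows "\<phi> (commutator x f) = commutator (\<phi> x) f"
proof -
  obtain k where n: "n = k + 2"
    using \<open>2 \<le> n\<close> by (metis add.commute le_Suc_ex)
  have "\<phi> (((\<lambda>y. commutator y f) ^^ k) (commutator x f)) =
      ((\<lambda>y. commutator y f) ^^ k) (commutator (\<phi> x) f)"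
    using lie_n_derivation_iterated_commutator [of smul k \<phi> f x f 0] phi
    by (simp add: n central commutator_central)
  then show ?thesis
    using right_semicentral_commutator_idem [OF f] by (simp add: funpow_commutator_block)
qed

text \<open>
  The Leibniz rule at \<open>a, b, f, \<dots>, f\<close> is the Lie derivation rule for \<open>[a, b]\<close> under an iterate of the
  projection \<open>[\<cdot>, f]\<close>.  Since \<open>\<phi>\<close> commutes with this projection, one more application of it turns the
  iterates into the projection itself, whatever \<open>n\<close> is.
\<close>

lemma lie_n_derivation_block_leibniz:
  assumes phi: "lie_n_derivation smul n \<phi>" and "2 \<le> n"
    and f: "right_semicentral f" and central: "\<phi> f \<in> centre"
  shows "commutator (\<phi> (commutator a b)) f =
    commutator (commutator (\<phi> a) b + commutator a (\<phi> b)) f"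
proof -
  obtain k where n: "n = k + 2"
    using \<open>2 \<le> n\<close> by (metis add.commute le_Suc_ex)
  let ?K = "\<lambda>y. commutator y f"
  have "\<phi> ((?K ^^ k) (commutator a b)) = (?K ^^ k) (commutator (\<phi> a) b + commutator a (\<phi> b))"
    using lie_n_derivation_iterated_commutator [of smul k \<phi> f a b 0] phi
    by (simp add: n central commutator_central)
  then have "\<phi> ((?K ^^ Suc k) (commutator a b)) =
      (?K ^^ Suc k) (commutator (\<phi> a) b + commutator a (\<phi> b))"
    by (simp add: lie_n_derivation_commutes_with_block [OF assms])
  then show ?thesis
    unfolding funpow_commutator_semicentral [OF f]
    by (simp add: lie_n_derivation_commutes_with_block [OF assms])
qed

text \<open>
  The cocycle condition on the values of \<open>\<phi>\<close> at commuting idempotents, which makes it possible to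
  normalise all of them by the same inner derivation.
\<close>

lemma lie_n_derivation_commuting_idempotents:
  assumes phi: "lie_n_derivation smul n \<phi>" and "2 \<le> n"
    and f: "right_semicentral f" and comm: "commutator g f = 0"
  shows "commutator (commutator (\<phi> g) f + commutator g (\<phi> f)) f = 0"
proof -
  obtain k where n: "n = k + 2"
    using \<open>2 \<le> n\<close> by (metis add.commute le_Suc_ex)
  let ?K = "\<lambda>y. commutator y f"
  have "\<phi> 0 = 0"
    using phi linear_map_zero by (auto simp: lie_n_derivation_def)
  then have "(?K ^^ k) (commutator (\<phi> g) f + commutator g (\<phi> f)) = 0"
    using lie_n_derivation_iterated_commutator [of smul k \<phi> f g f 0] phi
    by (simp add: n comm funpow_commutator_zero)
  then have "(?K ^^ Suc k) (commutator (\<phi> g) f + commutator g (\<phi> f)) = 0"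
    by simp
  then show ?thesis
    unfolding funpow_commutator_semicentral [OF f] .
qed

section \<open>Upper triangular matrices by entries\<close>

text \<open>
  The entries below the diagonal are discarded, so that any function of two indices gives a matrix;
  in particular \<open>mat_unit p q a\<close> below is zero for \<open>q < p\<close>.
\<close>

lift_definition ut_of :: "('s \<Rightarrow> 's \<Rightarrow> 'a) \<Rightarrow> ('a::zero, 's::{finite, linorder}) ut_matrix"
  is "\<lambda>g. \<chi> i j. if i \<le> j then g i j else 0"
  by auto

lemma entries_ut_of: "entries (ut_of g) $ i $ j = (if i \<le> j then g i j else 0)"
  by (simp add: ut_of.rep_eq)

definition mat_unit :: "'s \<Rightarrow> 's \<Rightarrow> 'a \<Rightarrow> ('a::zero, 's::{finite, linorder}) ut_matrix" where
  "mat_unit p q a = ut_of (\<lambda>i j. if i = p \<and> j = q then a else 0)"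

definition diag_idem :: "'s set \<Rightarrow> ('a::{ring, monoid_mult}, 's::{finite, linorder}) ut_matrix" where
  "diag_idem U = ut_of (\<lambda>i j. if i = j \<and> i \<in> U then 1 else 0)"

definition scalar_mat :: "'a \<Rightarrow> ('a::zero, 's::{finite, linorder}) ut_matrix" where
  "scalar_mat c = ut_of (\<lambda>i j. if i = j then c else 0)"

lemma entries_zero:
  "entries (0 :: ('a::{ring, monoid_mult}, 's::{finite, linorder}) ut_matrix) $ i $ j = 0"
  by (simp add: zero_ut_matrix.rep_eq)

lemma entries_minus: "entries (M - N) $ i $ j = entries M $ i $ j - entries N $ i $ j"
  by (simp add: minus_ut_matrix.rep_eq)

lemma entries_uminus: "entries (- M) $ i $ j = - entries M $ i $ j"
  by (simp add: uminus_ut_matrix.rep_eq)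

lemma entries_sum: "entries (\<Sum>k\<in>I. g k) $ i $ j = (\<Sum>k\<in>I. entries (g k) $ i $ j)"
  by (induction I rule: infinite_finite_induct) (simp_all add: entries_zero entries_plus)

lemma entries_mat_unit:
  "p \<le> q \<Longrightarrow> entries (mat_unit p q a) $ i $ j = (if i = p \<and> j = q then a else 0)"
  by (auto simp: mat_unit_def entries_ut_of)

lemma entries_diag_idem:
  "entries (diag_idem U) $ i $ j = (if i = j \<and> i \<in> U then 1 else 0)"
  by (auto simp: diag_idem_def entries_ut_of)

lemma entries_scalar_mat: "entries (scalar_mat c) $ i $ j = (if i = j then c else 0)"
  by (auto simp: scalar_mat_def entries_ut_of)

lemma entries_mult_mat_unit:
  "p \<le> q \<Longrightarrow> entries (M * mat_unit p q a) $ i $ j = (if j = q then entries M $ i $ p * a else 0)"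
  and entries_mat_unit_mult:
  "p \<le> q \<Longrightarrow> entries (mat_unit p q a * M) $ i $ j = (if i = p then a * entries M $ q $ j else 0)"
  by (simp_all add: entries_times entries_mat_unit if_distrib if_distribR cong: if_cong)

lemma entries_mult_diag_idem:
  "entries (M * diag_idem U) $ i $ j = (if j \<in> U then entries M $ i $ j else 0)"
  and entries_diag_idem_mult:
  "entries (diag_idem U * M) $ i $ j = (if i \<in> U then entries M $ i $ j else 0)"
proof -
  have "(\<Sum>k\<in>UNIV. entries M $ i $ k * (if k = j \<and> k \<in> U then 1 else 0)) =
      (\<Sum>k\<in>UNIV. if k = j then (if j \<in> U then entries M $ i $ j else 0) else 0)"
    by (intro sum.cong) auto
  then show "entries (M * diag_idem U) $ i $ j = (if j \<in> U then entries M $ i $ j else 0)"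
    by (simp add: entries_times entries_diag_idem)
  have "(\<Sum>k\<in>UNIV. (if i = k \<and> i \<in> U then 1 else 0) * entries M $ k $ j) =
      (\<Sum>k\<in>UNIV. if i = k then (if i \<in> U then entries M $ i $ j else 0) else 0)"
    by (intro sum.cong) auto
  then show "entries (diag_idem U * M) $ i $ j = (if i \<in> U then entries M $ i $ j else 0)"
    by (simp add: entries_times entries_diag_idem)
qed

lemma mat_unit_mult:
  "p \<le> q \<Longrightarrow> q' \<le> r \<Longrightarrow> mat_unit p q a * mat_unit q' r b = (if q = q' then mat_unit p r (a * b) else 0)"
  by (auto simp: ut_matrix_eq_iff entries_mult_mat_unit entries_mat_unit entries_zero)

lemma mat_unit_eq_zero_iff:
  "p \<le> q \<Longrightarrow> mat_unit p q a = (0 :: ('a::{ring, monoid_mult}, _) ut_matrix) \<longleftrightarrow> a = 0"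
  by (auto simp: ut_matrix_eq_iff entries_mat_unit entries_zero)

lemma scalar_mat_in_centre:
  assumes "c \<in> centre"
  shows "scalar_mat c \<in> (centre :: ('a::{ring, monoid_mult}, 's::{finite, linorder}) ut_matrix set)"
proof -
  have "entries (scalar_mat c * M) $ i $ j = c * entries M $ i $ j"
    "entries (M * scalar_mat c) $ i $ j = entries M $ i $ j * c"
    for M :: "('a, 's) ut_matrix" and i j
    by (simp_all add: entries_times entries_scalar_mat if_distrib if_distribR cong: if_cong)
  then show ?thesis
    using assms by (simp add: centre_def ut_matrix_eq_iff)
qed

lemma ut_matrix_sum_mat_unit:
  fixes M :: "('a::{ring, monoid_mult}, 's::{finite, linorder}) ut_matrix"
  shows "M = (\<Sum>(p, q) \<in> {(p, q). p \<le> q}. mat_unit p q (entries M $ p $ q))"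
proof -
  have "entries (\<Sum>(p, q) \<in> {(p, q). p \<le> q}. mat_unit p q (entries M $ p $ q)) $ i $ j = entries M $ i $ j"
    for i j
  proof -
    have "entries (\<Sum>(p, q) \<in> {(p, q). p \<le> q}. mat_unit p q (entries M $ p $ q)) $ i $ j =
      (\<Sum>x \<in> {(p, q). p \<le> q}. if x = (i, j) then entries M $ i $ j else 0)"
      unfolding entries_sum by (intro sum.cong) (auto simp: entries_mat_unit split: if_splits)
    then show ?thesis
      by (cases "i \<le> j") (simp_all add: not_le entries_below_diagonal)
  qed
  then show ?thesis
    by (simp add: ut_matrix_eq_iff)
qed

lemma additive_eq_zero:
  fixes g :: "('a::{ring, monoid_mult}, 's::{finite, linorder}) ut_matrix \<Rightarrow> 'b::ab_group_add"
  assumes add: "\<And>x y. g (x + y) = g x + g y"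
    and unit: "\<And>p q a. p \<le> q \<Longrightarrow> g (mat_unit p q a) = 0"
  shows "g x = 0"
proof -
  have "g 0 = 0"
    using add [of 0 0] by simp
  then have "g (\<Sum>k\<in>I. u k) = (\<Sum>k\<in>I. g (u k))" for I :: "('s \<times> 's) set" and u
    by (induction I rule: infinite_finite_induct) (simp_all add: add)
  then have "g (\<Sum>(p, q) \<in> {(p, q). p \<le> q}. mat_unit p q (entries x $ p $ q)) = 0"
    using unit by (auto intro!: sum.neutral)
  then show ?thesis
    using ut_matrix_sum_mat_unit [of x] by simp
qed

definition up_set :: "'s::linorder set \<Rightarrow> bool" where
  "up_set U \<longleftrightarrow> (\<forall>i j. i \<in> U \<longrightarrow> i \<le> j \<longrightarrow> j \<in> U)"

lemma up_set_atLeast: "up_set {k..}" and up_set_greaterThan: "up_set {k<..}"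
  by (auto simp: up_set_def)

lemma entries_commutator_diag_idem:
  "entries (commutator M (diag_idem U)) $ i $ j =
    (if j \<in> U then entries M $ i $ j else 0) - (if i \<in> U then entries M $ i $ j else 0)"
  by (simp add: commutator_def entries_minus entries_mult_diag_idem entries_diag_idem_mult)

text \<open>
  For a triangular matrix no entry has its row in the up-set \<open>U\<close> and its column outside, so only the
  block with rows outside \<open>U\<close> and columns in \<open>U\<close> survives.
\<close>

lemma entries_commutator_diag_idem_up_set:
  assumes "up_set U"
  shows "entries (commutator M (diag_idem U)) $ i $ j =
    (if i \<notin> U \<and> j \<in> U then entries M $ i $ j else 0)"
  using assms
  by (cases "i \<le> j") (auto simp: up_set_def entries_commutator_diag_idem entries_below_diagonal)

lemma right_semicentral_diag_idem:
  assumes "up_set U"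
  shows "right_semicentral (diag_idem U :: ('a::{ring, monoid_mult}, 's::{finite, linorder}) ut_matrix)"
proof -
  have "entries (diag_idem U * x * diag_idem U) $ i $ j = entries (diag_idem U * x) $ i $ j"
    for x :: "('a, 's) ut_matrix" and i j
    using assms
    by (cases "i \<le> j")
      (auto simp: up_set_def entries_mult_diag_idem entries_diag_idem_mult entries_below_diagonal)
  moreover have "diag_idem U * diag_idem U = (diag_idem U :: ('a, 's) ut_matrix)"
    by (auto simp: ut_matrix_eq_iff entries_mult_diag_idem entries_diag_idem)
  ultimately show ?thesis
    unfolding right_semicentral_def by (simp add: ut_matrix_eq_iff)
qed


lemma entries_commutator_diag_idem_left:
  "entries (commutator (diag_idem U) M) $ i $ j =
    (if i \<in> U then entries M $ i $ j else 0) - (if j \<in> U then entries M $ i $ j else 0)"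
  by (simp add: commutator_def entries_minus entries_mult_diag_idem entries_diag_idem_mult)

text \<open>
  Comparing the entries of \<open>a e\<^sub>p\<^sub>q y = y a e\<^sub>p\<^sub>q\<close>, for \<open>p\<close> outside and \<open>q\<close> in \<open>U\<close>, gives
  \<open>a y\<^sub>q\<^sub>q = y\<^sub>p\<^sub>p a\<close> and kills the rest of row \<open>q\<close> and of column \<open>p\<close>.  With \<open>a = 1\<close> all
  diagonal entries agree, because each index in \<open>U\<close> is linked to each index outside.  The
  entries with row outside \<open>U\<close> and column in \<open>U\<close> are not constrained.
\<close>

lemma block_commutant:
  fixes y :: "('a::{ring, monoid_mult}, 's::{finite, linorder}) ut_matrix"
  assumes U: "up_set U" "U \<noteq> {}" "U \<noteq> UNIV"
    and comm: "\<And>p q a. p \<notin> U \<Longrightarrow> q \<in> U \<Longrightarrow> commutator (mat_unit p q a) y = 0"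
  obtains c where "c \<in> centre"
    and "\<And>i j. i \<in> U \<or> j \<notin> U \<Longrightarrow> entries y $ i $ j = (if i = j then c else 0)"
proof -
  obtain p0 q0 where p0: "p0 \<notin> U" and q0: "q0 \<in> U"
    using U by auto
  have rel: "(if i = p then a * entries y $ q $ j else 0) = (if j = q then entries y $ i $ p * a else 0)"
    if "p \<notin> U" "q \<in> U" for p q a i j
  proof -
    have "p \<le> q"
      using that U(1) unfolding up_set_def by (meson linear)
    then show ?thesis
      using arg_cong [OF comm [OF that, of a], of "\<lambda>M. entries M $ i $ j"]
      by (simp add: commutator_def entries_minus entries_mult_mat_unit entries_mat_unit_mult entries_zero)
  qed
  define c where "c = entries y $ p0 $ p0"
  have diag: "a * entries y $ q $ q = entries y $ p $ p * a" if "p \<notin> U" "q \<in> U" for p q a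
    using rel [OF that, of p a q] by simp
  have row: "entries y $ q $ j = 0" if "q \<in> U" "j \<noteq> q" for q j
    using rel [OF p0 that(1), of p0 1 j] that(2) by simp
  have column: "entries y $ i $ p = 0" if "p \<notin> U" "i \<noteq> p" for i p
    using rel [OF that(1) q0, of i 1 q0] that(2) by simp
  have in_U: "entries y $ q $ q = c" if "q \<in> U" for q
    using diag [OF p0 that, of 1] by (simp add: c_def)
  have notin_U: "entries y $ p $ p = c" if "p \<notin> U" for p
    using diag [OF that q0, of 1] by (simp add: in_U [OF q0])
  have "c \<in> centre"
    using diag [OF p0 q0] by (simp add: centre_def in_U [OF q0] notin_U [OF p0])
  moreover have "entries y $ i $ j = (if i = j then c else 0)" if "i \<in> U \<or> j \<notin> U" for i j
    using that row [of i j] column [of j i] in_U [of i] notin_U [of i] by auto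
  ultimately show ?thesis
    using that by blast
qed

section \<open>Normalisation by an inner derivation\<close>

text \<open>
  The cocycle condition for \<open>f\<^sub>U\<close> and \<open>f\<^sub>V\<close> at an entry that lies in both blocks: bracketing with
  either idempotent multiplies this entry by the same sign.  Thus the block part of
  \<open>\<phi> f\<^sub>U\<close> at a given entry does not depend on \<open>U\<close>.
\<close>

lemma lie_n_derivation_diag_idem_entry:
  fixes \<phi> :: "('a::{ring, monoid_mult}, 's::{finite, linorder}) ut_matrix \<Rightarrow> ('a, 's) ut_matrix"
  assumes phi: "lie_n_derivation smul n \<phi>" and "2 \<le> n"
    and U: "p \<notin> U" "q \<in> U" and V: "up_set V" "p \<notin> V" "q \<in> V"
  shows "entries (\<phi> (diag_idem U)) $ p $ q = entries (\<phi> (diag_idem V)) $ p $ q"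
proof -
  let ?f = "diag_idem U :: ('a, 's) ut_matrix" and ?g = "diag_idem V :: ('a, 's) ut_matrix"
  have "commutator ?f ?g = 0"
    by (auto simp: ut_matrix_eq_iff entries_commutator_diag_idem entries_diag_idem entries_zero)
  then have "commutator (commutator (\<phi> ?f) ?g + commutator ?f (\<phi> ?g)) ?g = 0"
    by (rule lie_n_derivation_commuting_idempotents
        [OF phi \<open>2 \<le> n\<close> right_semicentral_diag_idem [OF V(1)]])
  then have "entries (commutator (commutator (\<phi> ?f) ?g + commutator ?f (\<phi> ?g)) ?g) $ p $ q = 0"
    by (simp add: entries_zero)
  then show ?thesis
    using U V
    by (simp add: entries_commutator_diag_idem entries_commutator_diag_idem_left entries_plus)
qed

text \<open>
  The entry \<open>(p, q)\<close> of \<open>w\<close> may be read off from any \<open>\<phi> f\<^sub>U\<close> whose block contains this position; the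
  choice \<open>U = {p<..}\<close> works for all \<open>q > p\<close> at once.
\<close>

lemma lie_n_derivation_normalise:
  fixes \<phi> :: "('a::{ring, monoid_mult}, 's::{finite, linorder}) ut_matrix \<Rightarrow> ('a, 's) ut_matrix"
  assumes phi: "lie_n_derivation smul n \<phi>" and n: "2 \<le> n"
    and torsion: "torsion_free (n - 1) TYPE(('a, 's) ut_matrix)"
  obtains w where "\<And>U. up_set U \<Longrightarrow> U \<noteq> {} \<Longrightarrow> U \<noteq> UNIV \<Longrightarrow>
    \<phi> (diag_idem U) - commutator w (diag_idem U) \<in> centre"
proof -
  define w where "w = ut_of (\<lambda>p q. entries (\<phi> (diag_idem {p<..})) $ p $ q)"
  have "\<phi> (diag_idem U) - commutator w (diag_idem U) \<in> centre"
    if U: "up_set U" "U \<noteq> {}" "U \<noteq> UNIV" for U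
  proof -
    have "commutator (mat_unit p q a) (\<phi> (diag_idem U)) = 0" if "p \<notin> U" "q \<in> U" for p q a
    proof -
      have "p \<le> q"
        using that U(1) unfolding up_set_def by (meson linear)
      then have "commutator (mat_unit p q a) (diag_idem U) = mat_unit p q a"
        using that by (auto simp: ut_matrix_eq_iff entries_commutator_diag_idem entries_mat_unit)
      then show ?thesis
        by (rule lie_n_derivation_block [OF phi n torsion right_semicentral_diag_idem [OF U(1)]])
    qed
    then obtain c where c: "c \<in> centre"
      and entry: "\<And>i j. i \<in> U \<or> j \<notin> U \<Longrightarrow>
        entries (\<phi> (diag_idem U)) $ i $ j = (if i = j then c else 0)"
      using block_commutant [OF U] by blast
    have "entries (\<phi> (diag_idem U) - commutator w (diag_idem U)) $ i $ j =
        entries (scalar_mat c) $ i $ j" for i j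
    proof (cases "i \<notin> U \<and> j \<in> U")
      case True
      then have "i < j"
        using U(1) unfolding up_set_def by (meson linear not_le)
      then have "entries w $ i $ j = entries (\<phi> (diag_idem U)) $ i $ j"
        using True
        by (simp add: w_def entries_ut_of less_imp_le
            lie_n_derivation_diag_idem_entry [OF phi n _ _ U(1), of i "{i<..}" j])
      then show ?thesis
        using True \<open>i < j\<close>
        by (auto simp: entries_minus entries_commutator_diag_idem entries_scalar_mat)
    next
      case False
      then show ?thesis
        using entry [of i j]
        by (auto simp: entries_minus entries_commutator_diag_idem_up_set [OF U(1)] entries_scalar_mat)
    qed
    then have "\<phi> (diag_idem U) - commutator w (diag_idem U) = scalar_mat c"
      by (simp add: ut_matrix_eq_iff)
    then show ?thesis
      by (simp add: scalar_mat_in_centre c)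
  qed
  then show ?thesis
    by (rule that)
qed

section \<open>Normalised Lie n-derivations\<close>

text \<open>
  What remains of the Lie \<open>n\<close>-derivation property after the normalisation, with \<open>n\<close> eliminated: the
  map preserves off-diagonal positions, and it is a Lie derivation as far as off-diagonal entries are
  concerned.  Nothing is known yet about diagonal entries of \<open>\<phi> [x, y]\<close>.
\<close>

locale off_diagonal_lie_derivation = unital_algebra smul
  for smul :: "'r::{comm_ring, comm_monoid_mult} \<Rightarrow> 'a::{ring, monoid_mult} \<Rightarrow> 'a" +
  fixes \<phi> :: "('a, 's::{finite, linorder}) ut_matrix \<Rightarrow> ('a, 's) ut_matrix"
  assumes linear: "linear_map (ut_smul smul) \<phi>"
    and entry: "p < q \<Longrightarrow> \<phi> (mat_unit p q (entries x $ p $ q)) = mat_unit p q (entries (\<phi> x) $ p $ q)"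
    and leibniz: "p < q \<Longrightarrow> entries (\<phi> (commutator x y)) $ p $ q =
      entries (commutator (\<phi> x) y + commutator x (\<phi> y)) $ p $ q"
    and card: "3 \<le> CARD('s)"
begin

lemma third_index: "\<exists>k::'s. k \<noteq> i \<and> k \<noteq> j"
proof (rule ccontr)
  assume "\<not> ?thesis"
  then have "(UNIV :: 's set) \<subseteq> {i, j}"
    by auto
  then have "CARD('s) \<le> card {i, j}"
    by (intro card_mono) auto
  also have "card {i, j} \<le> 2"
    by (simp add: card_insert_le_m1)
  finally show False
    using card by simp
qed

lemma phi_zero: "\<phi> 0 = 0"
  by (rule linear_map_zero [OF linear])

lemma phi_add: "\<phi> (x + y) = \<phi> x + \<phi> y"
  by (rule linear_map_add [OF linear])

lemma mat_unit_zero: "p \<le> q \<Longrightarrow> mat_unit p q 0 = (0 :: ('a, 's) ut_matrix)"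
  by (simp add: mat_unit_eq_zero_iff)

lemma mat_unit_add: "mat_unit p q (a + b) = mat_unit p q a + (mat_unit p q b :: ('a, 's) ut_matrix)"
  by (auto simp: ut_matrix_eq_iff mat_unit_def entries_ut_of entries_plus)

lemma phi_off_diagonal:
  "p < q \<Longrightarrow> \<phi> (mat_unit p q a) = mat_unit p q (entries (\<phi> (mat_unit p q a)) $ p $ q)"
  using entry [of p q "mat_unit p q a"] by (simp add: entries_mat_unit)

lemma phi_diagonal:
  assumes "i \<noteq> j"
  shows "entries (\<phi> (mat_unit k k a)) $ i $ j = 0"
proof (cases "i < j")
  case True
  then have "mat_unit i j (entries (\<phi> (mat_unit k k a)) $ i $ j) = (0 :: ('a, 's) ut_matrix)"
    using entry [of i j "mat_unit k k a"] assms
    by (cases "i = k") (auto simp: entries_mat_unit mat_unit_zero phi_zero)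
  then show ?thesis
    using True by (simp add: mat_unit_eq_zero_iff)
next
  case False
  then show ?thesis
    using assms by (simp add: entries_below_diagonal)
qed

text \<open>
  The matrices \<open>a e\<^sub>i\<^sub>i\<close> and \<open>b e\<^sub>p\<^sub>q\<close> commute, and \<open>\<phi> (b e\<^sub>p\<^sub>q)\<close> is again a multiple of \<open>e\<^sub>p\<^sub>q\<close>.  So
  the Leibniz rule at the position \<open>(p, q)\<close> says that \<open>[\<phi> (a e\<^sub>i\<^sub>i), b e\<^sub>p\<^sub>q]\<close> has entry zero there.
\<close>

lemma phi_diagonal_intertwines:
  assumes "p < q" "p \<noteq> i" "q \<noteq> i"
  shows "entries (\<phi> (mat_unit i i a)) $ p $ p * b = b * entries (\<phi> (mat_unit i i a)) $ q $ q"
proof -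
  have zero: "commutator (mat_unit i i a) (mat_unit p q b) = (0 :: ('a, 's) ut_matrix)" for b
    using assms by (simp add: commutator_def mat_unit_mult)
  have "commutator (mat_unit i i a) (\<phi> (mat_unit p q b)) = 0"
    using phi_off_diagonal [OF assms(1), of b] zero by metis
  then have "entries (commutator (\<phi> (mat_unit i i a)) (mat_unit p q b)) $ p $ q = 0"
    using leibniz [OF assms(1), of "mat_unit i i a" "mat_unit p q b"]
    by (simp add: zero phi_zero entries_zero)
  then show ?thesis
    using assms(1)
    by (simp add: commutator_def entries_minus entries_mult_mat_unit entries_mat_unit_mult)
qed

lemma phi_diagonal_eq:
  assumes "j \<noteq> i" "k \<noteq> i"
  shows "entries (\<phi> (mat_unit i i a)) $ j $ j = entries (\<phi> (mat_unit i i a)) $ k $ k"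
  using phi_diagonal_intertwines [of j k i a 1] phi_diagonal_intertwines [of k j i a 1] assms
  by (cases j k rule: linorder_cases) simp_all

text \<open>
  This is where three indices are needed: besides \<open>i\<close> and \<open>j\<close> a third index \<open>k\<close> provides an
  off-diagonal position that avoids row and column \<open>i\<close>.
\<close>

lemma phi_diagonal_central:
  assumes "j \<noteq> i"
  shows "entries (\<phi> (mat_unit i i a)) $ j $ j \<in> centre"
proof -
  obtain k where k: "k \<noteq> i" "k \<noteq> j"
    using third_index by blast
  have "entries (\<phi> (mat_unit i i a)) $ j $ j * b = b * entries (\<phi> (mat_unit i i a)) $ j $ j" for b
  proof (cases "j < k")
    case True
    from phi_diagonal_intertwines [OF this assms k(1)] show ?thesis
      by (simp only: phi_diagonal_eq [OF k(1) assms])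
  next
    case False
    with k(2) have "k < j"
      by simp
    from phi_diagonal_intertwines [OF this k(1) assms] show ?thesis
      by (simp only: phi_diagonal_eq [OF k(1) assms])
  qed
  then show ?thesis
    by (simp add: centre_def)
qed

definition other :: "'s \<Rightarrow> 's" where
  "other i = (SOME j. j \<noteq> i)"

lemma other_neq: "other i \<noteq> i"
  unfolding other_def using third_index [of i i] by (metis (mono_tags, lifting) someI_ex)

text \<open>
  For each \<open>i\<close>, the diagonal matrix \<open>\<phi> (x\<^sub>i\<^sub>i e\<^sub>i\<^sub>i)\<close> has a single value at all positions other than
  \<open>i\<close>, by \<open>phi_diagonal_eq\<close>; it is read off at the arbitrary position \<open>other i\<close>.
\<close>

definition central_part :: "('a, 's) ut_matrix \<Rightarrow> 'a" where
  "central_part x =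
    (\<Sum>i\<in>UNIV. entries (\<phi> (mat_unit i i (entries x $ i $ i))) $ other i $ other i)"

definition derivation_part :: "('a, 's) ut_matrix \<Rightarrow> ('a, 's) ut_matrix" where
  "derivation_part x = \<phi> x - scalar_mat (central_part x)"

lemma central_part_central: "central_part x \<in> centre"
proof -
  have "(\<Sum>i\<in>I. g i) \<in> centre" if "\<And>i. g i \<in> centre" for I :: "'s set" and g :: "'s \<Rightarrow> 'a"
    using that by (simp add: centre_def sum_distrib_left sum_distrib_right)
  then show ?thesis
    unfolding central_part_def by (simp add: phi_diagonal_central other_neq)
qed

lemma central_part_add: "central_part (x + y) = central_part x + central_part y"
  by (simp add: central_part_def entries_plus mat_unit_add phi_add sum.distrib)

lemma central_part_smul: "central_part (ut_smul smul r x) = smul r (central_part x)"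
proof -
  have "mat_unit i i (smul r a) = ut_smul smul r (mat_unit i i a :: ('a, 's) ut_matrix)" for i a
    by (simp add: ut_matrix_eq_iff entries_ut_smul entries_mat_unit)
  then show ?thesis
    using linear by (simp add: central_part_def entries_ut_smul linear_map_def smul_sum_right)
qed

lemma central_part_off_diagonal: "p < q \<Longrightarrow> central_part (mat_unit p q a) = 0"
  by (auto simp: central_part_def entries_mat_unit mat_unit_zero phi_zero entries_zero intro!: sum.neutral)

lemma central_part_diagonal:
  assumes "j \<noteq> i"
  shows "central_part (mat_unit i i a) = entries (\<phi> (mat_unit i i a)) $ j $ j"
proof -
  have "central_part (mat_unit i i a) =
      (\<Sum>k\<in>UNIV. if k = i then entries (\<phi> (mat_unit i i a)) $ other i $ other i else 0)"
    unfolding central_part_def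
    by (intro sum.cong) (auto simp: entries_mat_unit mat_unit_zero phi_zero entries_zero)
  then show ?thesis
    using phi_diagonal_eq [OF other_neq assms] by simp
qed

lemma linear_derivation_part: "linear_map (ut_smul smul) derivation_part"
proof -
  have "smul r (x - y) = smul r x - smul r y" for r x y
    using smul_right_distrib [of r "x - y" y] by simp
  then show ?thesis
    using linear
    by (auto simp: linear_map_def derivation_part_def central_part_add central_part_smul
        ut_matrix_eq_iff entries_plus entries_minus entries_scalar_mat entries_ut_smul)
qed

lemma derivation_part_mat_unit:
  assumes "p \<le> q"
  obtains c where "derivation_part (mat_unit p q a) = mat_unit p q c"
proof (cases "p = q")
  case True
  then have "derivation_part (mat_unit p q a) =
      mat_unit p q (entries (derivation_part (mat_unit p q a)) $ p $ q)"
    by (auto simp: ut_matrix_eq_iff derivation_part_def entries_minus entries_scalar_mat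
        entries_mat_unit phi_diagonal simp flip: central_part_diagonal)
  then show ?thesis
    by (rule that)
next
  case False
  then have "p < q"
    using assms by simp
  have "scalar_mat 0 = (0 :: ('a, 's) ut_matrix)"
    by (simp add: ut_matrix_eq_iff entries_scalar_mat entries_zero)
  then have "derivation_part (mat_unit p q a) = \<phi> (mat_unit p q a)"
    by (simp add: derivation_part_def central_part_off_diagonal \<open>p < q\<close>)
  then show ?thesis
    using phi_off_diagonal [OF \<open>p < q\<close>, of a] that by metis
qed

lemma derivation_part_leibniz:
  assumes "p < q"
  shows "entries (derivation_part (commutator x y)) $ p $ q =
    entries (commutator (derivation_part x) y + commutator x (derivation_part y)) $ p $ q"
  using leibniz [OF assms, of x y] assms
  by (simp add: derivation_part_def commutator_diff_left commutator_diff_right commutator_central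
      scalar_mat_in_centre central_part_central entries_minus entries_scalar_mat less_imp_neq)

text \<open>
  For \<open>p \<le> q \<le> r\<close> and \<open>p < r\<close> the product \<open>e\<^sub>p\<^sub>q e\<^sub>q\<^sub>r\<close> is a commutator, as the reversed product
  is zero.  So the product rule is the Leibniz rule at the off-diagonal position \<open>(p, r)\<close>.
\<close>

lemma derivation_part_mult_off_diagonal:
  assumes "p \<le> q" "q \<le> r" "p < r"
  shows "derivation_part (mat_unit p q a * mat_unit q r b) =
    derivation_part (mat_unit p q a) * mat_unit q r b +
    mat_unit p q a * derivation_part (mat_unit q r b)"
proof -
  obtain c d e where
    c: "derivation_part (mat_unit p q a) = mat_unit p q c" and
    d: "derivation_part (mat_unit q r b) = mat_unit q r d" and
    e: "derivation_part (mat_unit p r (a * b)) = mat_unit p r e"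
    using derivation_part_mat_unit assms by (metis less_imp_le)
  have comm: "commutator (mat_unit p q x) (mat_unit q r y) = mat_unit p r (x * y)" for x y :: 'a
    using assms by (auto simp: commutator_def mat_unit_mult)
  have "e = c * b + a * d"
    using derivation_part_leibniz [OF assms(3), of "mat_unit p q a" "mat_unit q r b"] assms
    by (simp add: c d e comm entries_mat_unit entries_plus)
  then show ?thesis
    using assms by (simp add: c d e mat_unit_mult mat_unit_add)
qed

text \<open>
  The Leibniz rule for commutators does not see diagonal entries.  But the defect of the product
  rule, a multiple of \<open>e\<^sub>i\<^sub>i\<close>, is annihilated by an off-diagonal unit: by \<open>e\<^sub>i\<^sub>q\<close> from the right if
  \<open>i < q\<close>, and by \<open>e\<^sub>q\<^sub>i\<close> from the left if \<open>q < i\<close>, since a product of two diagonal units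
  with it can be expanded in two ways by \<open>derivation_part_mult_off_diagonal\<close>.  Multiplication by such a
  unit is injective on multiples of \<open>e\<^sub>i\<^sub>i\<close>.
\<close>

lemma derivation_part_mult_diagonal:
  "derivation_part (mat_unit i i a * mat_unit i i b) =
    derivation_part (mat_unit i i a) * mat_unit i i b +
    mat_unit i i a * derivation_part (mat_unit i i b)"
proof -
  let ?D = derivation_part and ?x = "mat_unit i i a" and ?y = "mat_unit i i b"
  let ?z = "?D (?x * ?y) - ?D ?x * ?y - ?x * ?D ?y"
  obtain c d e where
    c: "?D ?x = mat_unit i i c" and d: "?D ?y = mat_unit i i d" and
    e: "?D (mat_unit i i (a * b)) = mat_unit i i e"
    using derivation_part_mat_unit by (metis order_refl)
  have xy: "?x * ?y = mat_unit i i (a * b)"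
    by (simp add: mat_unit_mult)
  have z: "?z = mat_unit i i (e - c * b - a * d)"
    by (simp add: c d e mat_unit_mult xy) (simp add: ut_matrix_eq_iff entries_minus entries_mat_unit)
  obtain q where "q \<noteq> i"
    using third_index by blast
  then consider "i < q" | "q < i"
    by (meson linorder_neqE)
  then have "e - c * b - a * d = 0"
  proof cases
    case 1
    let ?u = "mat_unit i q 1"
    have yu: "?y * ?u = mat_unit i q b"
      using 1 by (simp add: mat_unit_mult)
    have rule: "?D (mat_unit i i g * mat_unit i q h) =
        ?D (mat_unit i i g) * mat_unit i q h + mat_unit i i g * ?D (mat_unit i q h)" for g h
      using 1 by (intro derivation_part_mult_off_diagonal) simp_all
    have "?D (?x * ?y * ?u) = ?D (?x * ?y) * ?u + ?x * ?y * ?D ?u"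
      unfolding xy by (rule rule)
    moreover have "?D (?x * (?y * ?u)) = ?D ?x * (?y * ?u) + ?x * (?D ?y * ?u + ?y * ?D ?u)"
      using rule [of a b] rule [of b 1] by (simp add: yu)
    ultimately have "?z * ?u = 0"
      by (simp add: mult.assoc algebra_simps)
    then show ?thesis
      using 1 unfolding z by (simp add: mat_unit_mult mat_unit_eq_zero_iff)
  next
    case 2
    let ?u = "mat_unit q i 1"
    have ux: "?u * ?x = mat_unit q i a"
      using 2 by (simp add: mat_unit_mult)
    have rule: "?D (mat_unit q i h * mat_unit i i g) =
        ?D (mat_unit q i h) * mat_unit i i g + mat_unit q i h * ?D (mat_unit i i g)" for g h
      using 2 by (intro derivation_part_mult_off_diagonal) simp_all
    have "?D (?u * (?x * ?y)) = ?D ?u * (?x * ?y) + ?u * ?D (?x * ?y)"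
      unfolding xy by (rule rule)
    moreover have "?D (?u * ?x * ?y) = (?D ?u * ?x + ?u * ?D ?x) * ?y + ?u * ?x * ?D ?y"
      using rule [of a b] rule [of 1 a] by (simp add: ux)
    ultimately have "?u * ?z = 0"
      by (simp add: mult.assoc algebra_simps)
    then show ?thesis
      using 2 unfolding z by (simp add: mat_unit_mult mat_unit_eq_zero_iff)
  qed
  then have "?z = 0"
    unfolding z by (simp add: mat_unit_zero)
  then show ?thesis
    by (simp add: algebra_simps)
qed

text \<open>
  The defect \<open>\<Delta>\<close> of the product rule is biadditive, so it is enough that it vanishes on matrix units.
\<close>

lemma derivation_derivation_part: "derivation (ut_smul smul) derivation_part"
proof -
  let ?D = derivation_part
  define \<Delta> where "\<Delta> x y = ?D (x * y) - ?D x * y - x * ?D y" for x y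
  have left: "\<Delta> (x + y) z = \<Delta> x z + \<Delta> y z" and right: "\<Delta> z (x + y) = \<Delta> z x + \<Delta> z y" for x y z
    by (simp_all add: \<Delta>_def linear_map_add [OF linear_derivation_part] algebra_simps)
  have unit: "\<Delta> (mat_unit p q a) (mat_unit r t b) = 0" if "p \<le> q" "r \<le> t" for p q r t a b
  proof (cases "q = r")
    case True
    have "?D (mat_unit p q a * mat_unit q t b) =
        ?D (mat_unit p q a) * mat_unit q t b + mat_unit p q a * ?D (mat_unit q t b)"
    proof (cases "p = t")
      case True
      then show ?thesis
        using that \<open>q = r\<close> derivation_part_mult_diagonal [of p a b] by auto
    next
      case False
      then show ?thesis
        using that \<open>q = r\<close> by (intro derivation_part_mult_off_diagonal) auto
    qed
    then show ?thesis
      unfolding True \<Delta>_def by simp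
  next
    case False
    obtain c where "?D (mat_unit p q a) = mat_unit p q c"
      by (rule derivation_part_mat_unit [OF \<open>p \<le> q\<close>])
    moreover obtain d where "?D (mat_unit r t b) = mat_unit r t d"
      by (rule derivation_part_mat_unit [OF \<open>r \<le> t\<close>])
    ultimately show ?thesis
      using False that
      by (simp add: \<Delta>_def mat_unit_mult linear_map_zero [OF linear_derivation_part])
  qed
  have "\<Delta> (mat_unit p q a) y = 0" if "p \<le> q" for p q a y
    by (rule additive_eq_zero) (simp_all add: right unit that)
  then have "\<Delta> x y = 0" for x y
    by (rule additive_eq_zero [where g = "\<lambda>x. \<Delta> x y", OF left])
  then have "?D (x * y) = ?D x * y + x * ?D y" for x y
    by (simp add: \<Delta>_def algebra_simps)
  then show ?thesis
    using linear_derivation_part by (simp add: derivation_def)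
qed

lemma phi_minus_derivation_part_central: "\<phi> x - derivation_part x \<in> centre"
  by (simp add: derivation_part_def scalar_mat_in_centre central_part_central)

end

text \<open>
  All information comes from the projections \<open>[\<cdot>, f\<^sub>U]\<close>: \<open>\<phi>\<close> commutes with them, by centrality of \<open>\<phi> f\<^sub>U\<close>
  for proper non-empty \<open>U\<close> and because the projection is zero otherwise, and every off-diagonal position is
  obtained by combining such projections.
\<close>

lemma off_diagonal_lie_derivation_if_normalised:
  fixes smul :: "'r::{comm_ring, comm_monoid_mult} \<Rightarrow> 'a::{ring, monoid_mult} \<Rightarrow> 'a"
    and \<phi> :: "('a, 's::{finite, linorder}) ut_matrix \<Rightarrow> ('a, 's) ut_matrix"
  assumes alg: "unital_algebra smul" and card: "3 \<le> CARD('s)"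
    and phi: "lie_n_derivation (ut_smul smul) n \<phi>" and n: "2 \<le> n"
    and central: "\<And>U. up_set U \<Longrightarrow> U \<noteq> {} \<Longrightarrow> U \<noteq> UNIV \<Longrightarrow> \<phi> (diag_idem U) \<in> centre"
  shows "off_diagonal_lie_derivation smul \<phi>"
proof -
  interpret unital_algebra smul by fact
  have linear: "linear_map (ut_smul smul) \<phi>"
    using phi by (simp add: lie_n_derivation_def)
  have block: "\<phi> (commutator x (diag_idem U)) = commutator (\<phi> x) (diag_idem U)" if "up_set U" for U x
  proof (cases "U = {} \<or> U = UNIV")
    case True
    then have "commutator y (diag_idem U) = 0" for y :: "('a, 's) ut_matrix"
      by (auto simp: ut_matrix_eq_iff entries_commutator_diag_idem entries_zero)
    then show ?thesis
      by (simp add: linear_map_zero [OF linear])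
  next
    case False
    then show ?thesis
      using that
      by (intro lie_n_derivation_commutes_with_block [OF phi n] right_semicentral_diag_idem central)
        auto
  qed
  have entry: "\<phi> (mat_unit p q (entries x $ p $ q)) = mat_unit p q (entries (\<phi> x) $ p $ q)"
    if "p < q" for p q x
  proof -
    \<comment> \<open>\<open>E k\<close> is the commutator with the idempotent \<open>e\<^sub>k\<^sub>k\<close>, the difference of the idempotents of two
      up-sets; an off-diagonal entry survives \<open>E p\<close> and \<open>E q\<close> only at the position \<open>(p, q)\<close>.\<close>
    define E where "E k x = commutator x (diag_idem {k..}) - commutator x (diag_idem {k<..})"
      for k :: 's and x :: "('a, 's) ut_matrix"
    have "entries (E k x) $ i $ j =
        (if i < j \<and> j = k then entries x $ i $ j
         else if i < j \<and> i = k then - entries x $ i $ j else 0)" for k i j and x :: "('a, 's) ut_matrix"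
      by (cases "i \<le> j")
        (auto simp: E_def entries_minus entries_commutator_diag_idem entries_below_diagonal)
    then have "mat_unit p q (entries x $ p $ q) = - E q (E p x)" for x :: "('a, 's) ut_matrix"
      using that by (auto simp: ut_matrix_eq_iff entries_uminus entries_mat_unit)
    moreover have "\<phi> (E k x) = E k (\<phi> x)" for k x
      by (simp add: E_def linear_map_diff [OF linear] block up_set_atLeast up_set_greaterThan)
    moreover have "\<phi> (- x) = - \<phi> x" for x
      using linear_map_diff [OF linear, of 0 x] by (simp add: linear_map_zero [OF linear])
    ultimately show ?thesis
      by simp
  qed
  have leibniz: "entries (\<phi> (commutator x y)) $ p $ q =
      entries (commutator (\<phi> x) y + commutator x (\<phi> y)) $ p $ q" if "p < q" for p q x y
  proof -
    \<comment> \<open>The block of the up-set \<open>{q..}\<close> contains the position \<open>(p, q)\<close>.\<close>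
    have "\<phi> (diag_idem {q..}) \<in> centre"
      using that by (intro central up_set_atLeast) (auto simp: set_eq_iff not_le)
    then have "commutator (\<phi> (commutator x y)) (diag_idem {q..}) =
        commutator (commutator (\<phi> x) y + commutator x (\<phi> y)) (diag_idem {q..})"
      by (intro lie_n_derivation_block_leibniz [OF phi n] right_semicentral_diag_idem up_set_atLeast)
    from arg_cong [OF this, of "\<lambda>M. entries M $ p $ q"] show ?thesis
      using that by (simp add: entries_commutator_diag_idem not_le [THEN iffD2])
  qed
  show ?thesis
    by unfold_locales (use linear entry leibniz card in auto)
qed

theorem corollary3p7:
  fixes smul :: "'r::{comm_ring, comm_monoid_mult} \<Rightarrow> 'a::{ring, monoid_mult} \<Rightarrow> 'a"
    and n :: nat
    and \<phi> :: "('a, 's::{finite, linorder}) ut_matrix \<Rightarrow> ('a, 's) ut_matrix"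
  assumes "n \<ge> 2"
    and "CARD('s) \<ge> 3"
    and "unital_algebra smul"
    and "torsion_free 2 TYPE(('a, 's) ut_matrix)"
    and "torsion_free (n - 1) TYPE(('a, 's) ut_matrix)"
    and "lie_n_derivation (ut_smul smul) n \<phi>"
  shows "standard_lie_n_derivation (ut_smul smul) n \<phi>"
proof -
  have alg: "unital_algebra (ut_smul smul :: 'r \<Rightarrow> ('a, 's) ut_matrix \<Rightarrow> ('a, 's) ut_matrix)"
    by (rule unital_algebra.unital_algebra_ut_smul) fact
  obtain w where w: "\<And>U. up_set U \<Longrightarrow> U \<noteq> {} \<Longrightarrow> U \<noteq> UNIV \<Longrightarrow>
      \<phi> (diag_idem U) - commutator w (diag_idem U) \<in> centre"
    using lie_n_derivation_normalise [OF assms(6,1,5)] by blast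
  let ?\<psi> = "\<lambda>x. \<phi> x - commutator w x"
  have inner: "derivation (ut_smul smul) (commutator w)"
    by (rule derivation_inner [OF alg])
  have "lie_n_derivation (ut_smul smul) n ?\<psi>"
    by (intro lie_n_derivation_diff alg assms(6) lie_n_derivation_if_derivation inner)
  then interpret off_diagonal_lie_derivation smul ?\<psi>
    by (rule off_diagonal_lie_derivation_if_normalised [OF assms(3,2) _ assms(1)]) (rule w)
  let ?h = "\<lambda>x. derivation_part x + commutator w x"
  have "derivation (ut_smul smul) ?h"
    using derivation_derivation_part inner
    by (auto simp: derivation_def linear_map_def algebra_simps unital_algebra.smul_right_distrib [OF alg])
  moreover have "\<phi> x - ?h x \<in> centre" for x
    using phi_minus_derivation_part_central [of x] by (simp add: algebra_simps)
  ultimately show ?thesis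
    by (rule standard_if_derivation_plus_central [OF alg assms(1,6)])
qed

end
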